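(* Let $R$ be a field, let $I$ be a strong involutive division on the monomials of $R\langle x_1,\dots,x_n\rangle$, and let $O$ be an admissible monomial ordering. If a finite set $G\subset R\langle x_1,\dots,x_n\rangle$ of nonzero polynomials is an Involutive Basis with respect to $I$ and $O$, then $G$ is a (noncommutative) Gröbner Basis, with respect to $O$, of the two-sided ideal it generates.
   Context: Monomials are words in the noncommuting variables $x_1,\dots,x_n$; a monomial ordering (total order on monomials) is admissible if $1<m$ for all $m\neq 1$ and $m_1<m_2$ implies $\ell m_1 r<\ell m_2 r$ for all monomials $\ell,r$. $\mathrm{LM},\mathrm{LT},\mathrm{LC}$ denote leading monomial, term, coefficient. A set $G$ is a noncommutative Gröbner Basis if all S-polynomials of elements of $G$ (one for each overlap of leading monomials, including self overlaps) reduce to zero using $G$; equivalently, the leading monomial of every nonzero element of the two-sided ideal generated by $G$ contains some $\mathrm{LM}(g)$, $g\in G$, as a subword. Involutive division. A rule $I$ assigning to every finite set $U$ of monomials and every $u\in U$ a set $\mathcal M^L_I(u,U)\subseteq\{x_1,\dots,x_n\}$ of left multiplicative variables and a set $\mathcal M^R_I(u,U)\subseteq\{x_1,\dots,x_n\}$ of right multiplicative variables. For $u\in U$ and a factorisation $w=v_1uv_2$, $u$ is an involutive divisor of $w$ at this factorisation if (thin divisors) the last letter of $v_1$ (if $v_1\ne1$) is in $\mathcal M^L_I(u,U)$ and the first letter of $v_2$ (if $v_2\neq1$) is in $\mathcal M^R_I(u,U)$. Write $u\mid_I w$ if this holds for some factorisation, and let $\mathcal C_I(u,U)=\{w : u\mid_I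 w\}$. $I$ is strong if for every finite $U$: (Disjoint Cones) if $\mathcal C_I(u_1,U)\cap\mathcal C_I(u_2,U)\ne\emptyset$ for $u_1,u_2\in U$, then one of these cones is contained in the other; (Unique Divisor) each $w\in\mathcal C_I(u,U)$ is involutively divisible by $u$ at exactly one factorisation; (Subset) if $V\subset U$ then $\mathcal M^L_I(v,U)\subseteq\mathcal M^L_I(v,V)$ and $\mathcal M^R_I(v,U)\subseteq\mathcal M^R_I(v,V)$ for all $v\in V$. For a finite set $P$ of nonzero polynomials, multiplicative variables of $p\in P$ are those of $\mathrm{LM}(p)$ with respect to $U=\mathrm{LM}(P)$. Involutive reduction of $f$ by $P$: repeatedly take the leading term $c\,w$ of the current polynomial; if some $\mathrm{LM}(p)$, $p\in P$, involutively divides $w$ at $w=v_1\mathrm{LM}(p)v_2$, subtract $c\,\mathrm{LC}(p)^{-1}v_1pv_2$; otherwise move $c\,w$ to the remainder. $f$ involutively reduces to zero using $P$ if the final remainder is $0$. $P$ is autoreduced if no $p\in P$ contains a term whose monomial is involutively divisible (multiplicative variables taken over $P$) by $\mathrm{LM}(p')$ for some $p'\in P\setminus\{p\}$. An autoreduced $P$ is an Involutive Basis with respect to $I$ and $O$ if $upv$ involutively reduces to zero using $P$ for all $p\in P$ and all terms $u,v$. *)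

theory Defs
  imports Complex_Main "HOL.Hull" "HOL-Library.Poly_Mapping"
begin

text \<open>
  Monomials in the noncommuting variables of type \<open>'x\<close> are words \<open>'x list\<close>. They form the free
  monoid; it is written additively here only because the multiplication of \<open>poly_mapping\<close> is the
  convolution product over an additive monoid. With this instance \<open>'x list \<Rightarrow>\<^sub>0 'k\<close> is, as a
  library \<open>ring_1\<close>, the free associative algebra over \<open>'k\<close>.
\<close>

instantiation list :: (type) monoid_add
begin

definition zero_list :: "'a list"
  where "zero_list = []"

definition plus_list :: "'a list \<Rightarrow> 'a list \<Rightarrow> 'a list"
  where "plus_list = (@)"

instance
  by standard (simp_all add: zero_list_def plus_list_def)

end

type_synonym ('x, 'k) ncpoly = "'x list \<Rightarrow>\<^sub>0 'k"

abbreviation monomial :: "'x list \<Rightarrow> ('x, 'k::field) ncpoly"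
  where "monomial m \<equiv> Poly_Mapping.single m 1"

definition is_term :: "('x, 'k::field) ncpoly \<Rightarrow> bool"
  where "is_term t \<longleftrightarrow> (\<exists>c m. c \<noteq> 0 \<and> t = Poly_Mapping.single m c)"

definition two_sided_ideal :: "'r::ring_1 set \<Rightarrow> bool"
  where "two_sided_ideal J \<longleftrightarrow>
    0 \<in> J \<and> (\<forall>a\<in>J. \<forall>b\<in>J. a + b \<in> J) \<and> (\<forall>a\<in>J. \<forall>s. s * a \<in> J \<and> a * s \<in> J)"


text \<open>A monomial ordering is given by its strict part: \<open>(m, m') \<in> ord\<close> means \<open>m < m'\<close>.\<close>

definition admissible :: "'x list rel \<Rightarrow> bool"
  where "admissible ord \<longleftrightarrow>
    strict_linear_order ord \<and>
    (\<forall>m. m \<noteq> [] \<longrightarrow> ([], m) \<in> ord) \<and>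
    (\<forall>m1 m2 l r. (m1, m2) \<in> ord \<longrightarrow> (l @ m1 @ r, l @ m2 @ r) \<in> ord)"

text \<open>Meaningful for nonzero polynomials only.\<close>

definition LM :: "'x list rel \<Rightarrow> ('x, 'k::field) ncpoly \<Rightarrow> 'x list"
  where "LM ord f =
    (THE m. m \<in> Poly_Mapping.keys f \<and> (\<forall>m'\<in>Poly_Mapping.keys f. m' \<noteq> m \<longrightarrow> (m', m) \<in> ord))"

definition LC :: "'x list rel \<Rightarrow> ('x, 'k::field) ncpoly \<Rightarrow> 'k"
  where "LC ord f = Poly_Mapping.lookup f (LM ord f)"

definition LT :: "'x list rel \<Rightarrow> ('x, 'k::field) ncpoly \<Rightarrow> ('x, 'k) ncpoly"
  where "LT ord f = Poly_Mapping.single (LM ord f) (LC ord f)"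

text \<open>
  One step of the division algorithm on a pair (current polynomial, remainder so far). The
  predicate \<open>D p v1 v2\<close> says which factorisations \<open>v1 LM(p) v2\<close> of the leading monomial may be used:
  all of them for ordinary reduction, the involutive ones for involutive reduction.
\<close>

inductive reduction_step ::
  "'x list rel \<Rightarrow> (('x, 'k::field) ncpoly \<Rightarrow> 'x list \<Rightarrow> 'x list \<Rightarrow> bool) \<Rightarrow> ('x, 'k) ncpoly set \<Rightarrow>
    ('x, 'k) ncpoly \<times> ('x, 'k) ncpoly \<Rightarrow> ('x, 'k) ncpoly \<times> ('x, 'k) ncpoly \<Rightarrow> bool"
  for ord D P
  where
    subtract:
      "\<lbrakk>f \<noteq> 0; p \<in> P; LM ord f = v1 @ LM ord p @ v2; D p v1 v2\<rbrakk> \<Longrightarrow>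
       reduction_step ord D P (f, r)
         (f - Poly_Mapping.single v1 (LC ord f * inverse (LC ord p)) * p * monomial v2, r)"
  | to_remainder:
      "\<lbrakk>f \<noteq> 0; \<not> (\<exists>p\<in>P. \<exists>v1 v2. LM ord f = v1 @ LM ord p @ v2 \<and> D p v1 v2)\<rbrakk> \<Longrightarrow>
       reduction_step ord D P (f, r) (f - LT ord f, r + LT ord f)"

text \<open>Some run of the algorithm on \<open>f\<close> ends with remainder zero.\<close>

definition reduces_to_zero ::
  "'x list rel \<Rightarrow> (('x, 'k::field) ncpoly \<Rightarrow> 'x list \<Rightarrow> 'x list \<Rightarrow> bool) \<Rightarrow> ('x, 'k) ncpoly set \<Rightarrow>
    ('x, 'k) ncpoly \<Rightarrow> bool"
  where "reduces_to_zero ord D P f \<longleftrightarrow> (reduction_step ord D P)\<^sup>*\<^sup>* (f, 0) (0, 0)"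


text \<open>
  \<open>overlap m1 l1 r1 m2 l2 r2\<close>: the word \<open>l1 m1 r1 = l2 m2 r2\<close> is a smallest common multiple in which
  the two occurrences share at least one letter (the length conditions). This covers one monomial
  being a subword of the other as well as a suffix of one being a prefix of the other. For
  \<open>m1 = m2\<close> it gives the self overlaps; the trivial placement of a monomial on itself is not
  excluded, as the S-polynomial of an element with itself there is \<open>0\<close>.
\<close>

definition overlap ::
  "'x list \<Rightarrow> 'x list \<Rightarrow> 'x list \<Rightarrow> 'x list \<Rightarrow> 'x list \<Rightarrow> 'x list \<Rightarrow> bool"
  where "overlap m1 l1 r1 m2 l2 r2 \<longleftrightarrow>
    l1 @ m1 @ r1 = l2 @ m2 @ r2 \<and>
    (l1 = [] \<or> l2 = []) \<and> (r1 = [] \<or> r2 = []) \<and>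
    length l1 < length l2 + length m2 \<and> length l2 < length l1 + length m1"

definition S_polynomials ::
  "'x list rel \<Rightarrow> ('x, 'k::field) ncpoly set \<Rightarrow> ('x, 'k) ncpoly set"
  where "S_polynomials ord G =
    {Poly_Mapping.single l1 (LC ord g2) * g1 * monomial r1
       - Poly_Mapping.single l2 (LC ord g1) * g2 * monomial r2 | g1 l1 r1 g2 l2 r2.
     g1 \<in> G \<and> g2 \<in> G \<and> overlap (LM ord g1) l1 r1 (LM ord g2) l2 r2}"

definition groebner_basis ::
  "'x list rel \<Rightarrow> ('x, 'k::field) ncpoly set \<Rightarrow> ('x, 'k) ncpoly set \<Rightarrow> bool"
  where "groebner_basis ord G J \<longleftrightarrow>
    J = two_sided_ideal hull G \<and>
    (\<forall>s\<in>S_polynomials ord G. reduces_to_zero ord (\<lambda>_ _ _. True) G s)"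


text \<open>
  \<open>I u U\<close> is the pair (left multiplicative variables, right multiplicative variables) of \<open>u\<close> with
  respect to \<open>U\<close>. Only its values for finite \<open>U\<close> and \<open>u \<in> U\<close> matter.
\<close>

type_synonym 'x involutive_division = "'x list \<Rightarrow> 'x list set \<Rightarrow> 'x set \<times> 'x set"

definition left_mult_vars :: "'x involutive_division \<Rightarrow> 'x list \<Rightarrow> 'x list set \<Rightarrow> 'x set"
  where "left_mult_vars I u U = fst (I u U)"

definition right_mult_vars :: "'x involutive_division \<Rightarrow> 'x list \<Rightarrow> 'x list set \<Rightarrow> 'x set"
  where "right_mult_vars I u U = snd (I u U)"

text \<open>\<open>u\<close> is an involutive (thin) divisor of \<open>v1 u v2\<close> at this factorisation.\<close>

definition inv_div_at ::
  "'x involutive_division \<Rightarrow> 'x list set \<Rightarrow> 'x list \<Rightarrow> 'x list \<Rightarrow> 'x list \<Rightarrow> bool"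
  where "inv_div_at I U u v1 v2 \<longleftrightarrow>
    (v1 \<noteq> [] \<longrightarrow> last v1 \<in> left_mult_vars I u U) \<and>
    (v2 \<noteq> [] \<longrightarrow> hd v2 \<in> right_mult_vars I u U)"

definition inv_dvd :: "'x involutive_division \<Rightarrow> 'x list set \<Rightarrow> 'x list \<Rightarrow> 'x list \<Rightarrow> bool"
  where "inv_dvd I U u w \<longleftrightarrow> (\<exists>v1 v2. w = v1 @ u @ v2 \<and> inv_div_at I U u v1 v2)"

definition inv_cone :: "'x involutive_division \<Rightarrow> 'x list set \<Rightarrow> 'x list \<Rightarrow> 'x list set"
  where "inv_cone I U u = {w. inv_dvd I U u w}"

definition disjoint_cones :: "'x involutive_division \<Rightarrow> 'x list set \<Rightarrow> bool"
  where "disjoint_cones I U \<longleftrightarrow>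
    (\<forall>u1\<in>U. \<forall>u2\<in>U. inv_cone I U u1 \<inter> inv_cone I U u2 \<noteq> {} \<longrightarrow>
      inv_cone I U u1 \<subseteq> inv_cone I U u2 \<or> inv_cone I U u2 \<subseteq> inv_cone I U u1)"

definition unique_divisor :: "'x involutive_division \<Rightarrow> 'x list set \<Rightarrow> bool"
  where "unique_divisor I U \<longleftrightarrow>
    (\<forall>u\<in>U. \<forall>w\<in>inv_cone I U u. \<exists>!(v1, v2). w = v1 @ u @ v2 \<and> inv_div_at I U u v1 v2)"

definition subset_condition :: "'x involutive_division \<Rightarrow> 'x list set \<Rightarrow> bool"
  where "subset_condition I U \<longleftrightarrow>
    (\<forall>V. V \<subset> U \<longrightarrow> (\<forall>v\<in>V.
      left_mult_vars I v U \<subseteq> left_mult_vars I v V \<and>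
      right_mult_vars I v U \<subseteq> right_mult_vars I v V))"

definition strong :: "'x involutive_division \<Rightarrow> bool"
  where "strong I \<longleftrightarrow>
    (\<forall>U. finite U \<longrightarrow> disjoint_cones I U \<and> unique_divisor I U \<and> subset_condition I U)"

definition inv_reduces_to_zero ::
  "'x list rel \<Rightarrow> 'x involutive_division \<Rightarrow> ('x, 'k::field) ncpoly set \<Rightarrow> ('x, 'k) ncpoly \<Rightarrow> bool"
  where "inv_reduces_to_zero ord I P f \<longleftrightarrow>
    reduces_to_zero ord (\<lambda>p v1 v2. inv_div_at I (LM ord ` P) (LM ord p) v1 v2) P f"

definition autoreduced ::
  "'x list rel \<Rightarrow> 'x involutive_division \<Rightarrow> ('x, 'k::field) ncpoly set \<Rightarrow> bool"
  where "autoreduced ord I P \<longleftrightarrow>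
    (\<forall>p\<in>P. \<forall>w\<in>Poly_Mapping.keys p. \<forall>p'\<in>P - {p}. \<not> inv_dvd I (LM ord ` P) (LM ord p') w)"

definition involutive_basis ::
  "'x list rel \<Rightarrow> 'x involutive_division \<Rightarrow> ('x, 'k::field) ncpoly set \<Rightarrow> bool"
  where "involutive_basis ord I P \<longleftrightarrow>
    autoreduced ord I P \<and>
    (\<forall>p\<in>P. \<forall>u v. is_term u \<and> is_term v \<longrightarrow> inv_reduces_to_zero ord I P (u * p * v))"

end

theory Submission
  imports Defs
begin

text \<open>
  The multiples \<open>v1 p v2\<close> of basis elements at involutive factorisations have pairwise distinct
  leading monomials, since involutive divisors are unique when the division is strong and the basis
  autoreduced. Each term multiple of a basis element, hence each S-polynomial, lies in their linear
  span. The leading monomial of a nontrivial combination of them is the largest one among its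
  summands, so a reduction step can remove that summand exactly; the reduction ends after as many
  steps as there are summands, and well-foundedness of the ordering plays no role.
\<close>

section \<open>Two-sided multiplication by terms\<close>

text \<open>Cancellation in the free monoid makes \<open>m \<mapsto> v1 @ m @ v2\<close> injective,
  so no two coefficients of \<open>p\<close> are merged. Both sides are additive in
  \<open>p\<close>, which reduces the claim to a single term.\<close>

lemma lookup_single_mult_single:
  fixes p :: "('x, 'k::field) ncpoly"
  shows "Poly_Mapping.lookup (Poly_Mapping.single v1 c * p * Poly_Mapping.single v2 d) (v1 @ m @ v2) =
    c * Poly_Mapping.lookup p m * d"
proof (induction p rule: update_induct)
  case (update p k a)
  \<comment> \<open>The induction adds a fresh key, so the update overwrites only a zero
    coefficient.\<close>
  have "Poly_Mapping.update k a p = p + Poly_Mapping.single k a"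
    using update by (intro poly_mapping_eqI) (auto simp: lookup_update lookup_add lookup_single in_keys_iff)
  moreover have "Poly_Mapping.lookup (Poly_Mapping.single v1 c * Poly_Mapping.single k a *
      Poly_Mapping.single v2 d) (v1 @ m @ v2) = c * Poly_Mapping.lookup (Poly_Mapping.single k a) m * d"
    by (simp add: mult_single lookup_single when_def plus_list_def)
  ultimately show ?case using update by (simp add: lookup_add distrib_left distrib_right)
qed simp

lemma keys_single_mult_single:
  fixes p :: "('x, 'k::field) ncpoly"
  shows "Poly_Mapping.keys (Poly_Mapping.single v1 c * p * Poly_Mapping.single v2 d) \<subseteq>
    (\<lambda>m. v1 @ m @ v2) ` Poly_Mapping.keys p"
proof
  fix w assume "w \<in> Poly_Mapping.keys (Poly_Mapping.single v1 c * p * Poly_Mapping.single v2 d)"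
  then obtain a b where w: "w = a + b" and a: "a \<in> Poly_Mapping.keys (Poly_Mapping.single v1 c * p)"
    and b: "b \<in> Poly_Mapping.keys (Poly_Mapping.single v2 d)"
    using keys_mult by fast
  from a obtain a1 m where "a = a1 + m" "a1 \<in> Poly_Mapping.keys (Poly_Mapping.single v1 c)"
    and m: "m \<in> Poly_Mapping.keys p"
    using keys_mult by fast
  with b w have "w = v1 @ m @ v2"
    by (simp add: plus_list_def split: if_splits)
  with m show "w \<in> (\<lambda>m. v1 @ m @ v2) ` Poly_Mapping.keys p" by blast
qed

section \<open>Admissible orderings and leading monomials\<close>

lemma admissible_linear:
  assumes "admissible ord"
  shows "trans ord" "irrefl ord" "total ord"
  using assms by (auto simp: admissible_def strict_linear_order_on_def)

lemma admissible_context: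
  assumes "admissible ord" "(m1, m2) \<in> ord"
  shows "(l @ m1 @ r, l @ m2 @ r) \<in> ord"
  using assms by (auto simp: admissible_def)

lemma finite_strict_linear_order_max:
  assumes "trans ord" "total ord" "finite A" "A \<noteq> {}"
  shows "\<exists>m\<in>A. \<forall>m'\<in>A. m' \<noteq> m \<longrightarrow> (m', m) \<in> ord"
  using assms(3,4)
proof (induction rule: finite_ne_induct)
  case (insert x F)
  then obtain m where m: "m \<in> F" "\<forall>m'\<in>F. m' \<noteq> m \<longrightarrow> (m', m) \<in> ord" by blast
  then show ?case
  proof (cases "(x, m) \<in> ord")
    case False
    with m(1) insert.hyps assms(2) have "(m, x) \<in> ord" by (metis UNIV_I total_on_def)
    with m assms(1) show ?thesis by (metis insertE insertI1 transD)
  qed blast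
qed simp

lemma LM_eqI:
  assumes "admissible ord" "m \<in> Poly_Mapping.keys f"
    "\<And>m'. m' \<in> Poly_Mapping.keys f \<Longrightarrow> m' \<noteq> m \<Longrightarrow> (m', m) \<in> ord"
  shows "LM ord f = m"
  unfolding LM_def
proof (rule the_equality)
  fix n assume n: "n \<in> Poly_Mapping.keys f \<and> (\<forall>m'\<in>Poly_Mapping.keys f. m' \<noteq> n \<longrightarrow> (m', n) \<in> ord)"
  show "n = m"
  proof (rule ccontr)
    assume "n \<noteq> m"
    with n assms have "(n, m) \<in> ord" "(m, n) \<in> ord" by auto
    with admissible_linear[OF assms(1)] show False by (meson irrefl_def transD)
  qed
qed (use assms in auto)

lemma
  assumes "admissible ord" "f \<noteq> 0"
  shows LM_in_keys: "LM ord f \<in> Poly_Mapping.keys f"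
    and LM_greatest: "m \<in> Poly_Mapping.keys f \<Longrightarrow> m \<noteq> LM ord f \<Longrightarrow> (m, LM ord f) \<in> ord"
proof -
  obtain n where n: "n \<in> Poly_Mapping.keys f"
    "\<forall>m'\<in>Poly_Mapping.keys f. m' \<noteq> n \<longrightarrow> (m', n) \<in> ord"
    using finite_strict_linear_order_max[of ord "Poly_Mapping.keys f"] assms
      admissible_linear[OF assms(1)] by auto
  with assms(1) have "LM ord f = n" by (intro LM_eqI) auto
  with n show "LM ord f \<in> Poly_Mapping.keys f"
    "m \<in> Poly_Mapping.keys f \<Longrightarrow> m \<noteq> LM ord f \<Longrightarrow> (m, LM ord f) \<in> ord" by auto
qed

text \<open>Placing words on both sides preserves the ordering and the coefficients, so the greatest
  monomial of \<open>p\<close> is carried to the greatest monomial of the product.\<close>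

lemma
  fixes p :: "('x, 'k::field) ncpoly"
  assumes "admissible ord" "p \<noteq> 0"
  shows LM_mult_monomials: "LM ord (monomial v1 * p * monomial v2) = v1 @ LM ord p @ v2"
    and LC_mult_monomials: "LC ord (monomial v1 * p * monomial v2) = LC ord p"
    and mult_monomials_nonzero: "monomial v1 * p * monomial v2 \<noteq> 0"
proof -
  have l: "Poly_Mapping.lookup (monomial v1 * p * monomial v2) (v1 @ LM ord p @ v2) = LC ord p"
    by (simp add: lookup_single_mult_single LC_def)
  have nz: "LC ord p \<noteq> 0"
    using LM_in_keys[OF assms] by (simp add: LC_def in_keys_iff)
  show "LM ord (monomial v1 * p * monomial v2) = v1 @ LM ord p @ v2"
  proof (rule LM_eqI[OF assms(1)])
    show "v1 @ LM ord p @ v2 \<in> Poly_Mapping.keys (monomial v1 * p * monomial v2)"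
      using l nz by (simp add: in_keys_iff)
  next
    fix m' assume "m' \<in> Poly_Mapping.keys (monomial v1 * p * monomial v2)" and ne: "m' \<noteq> v1 @ LM ord p @ v2"
    then obtain m where "m \<in> Poly_Mapping.keys p" "m' = v1 @ m @ v2"
      using keys_single_mult_single by blast
    with ne show "(m', v1 @ LM ord p @ v2) \<in> ord"
      using LM_greatest[OF assms, of m] admissible_context[OF assms(1)] by auto
  qed
  with l show "LC ord (monomial v1 * p * monomial v2) = LC ord p"
    by (simp add: LC_def)
  show "monomial v1 * p * monomial v2 \<noteq> 0" using l nz by auto
qed

section \<open>Linear spans of multiples\<close>

text \<open>Scaling is multiplication by a constant polynomial, so that the vector space laws follow
  from the ring laws.\<close>

definition ncpoly_scale :: "'k \<Rightarrow> ('x, 'k::field) ncpoly \<Rightarrow> ('x, 'k) ncpoly"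
  where "ncpoly_scale c f = Poly_Mapping.single [] c * f"

interpretation ncpoly: vector_space "ncpoly_scale :: 'k::field \<Rightarrow> ('x, 'k) ncpoly \<Rightarrow> ('x, 'k) ncpoly"
proof
  have 1: "Poly_Mapping.single [] 1 = (1 :: ('x, 'k) ncpoly)"
    by (metis single_one zero_list_def)
  show "ncpoly_scale 1 x = x" for x :: "('x, 'k) ncpoly"
    by (simp add: ncpoly_scale_def 1)
qed (simp_all add: ncpoly_scale_def distrib_left distrib_right single_add mult_single plus_list_def
       flip: mult.assoc)

lemma ncpoly_scale_mult_monomials:
  "ncpoly_scale c (monomial v1 * p * monomial v2) = Poly_Mapping.single v1 c * p * monomial v2"
  by (simp add: ncpoly_scale_def mult_single plus_list_def flip: mult.assoc)

lemma lookup_ncpoly_scale: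
  fixes f :: "('x, 'k::field) ncpoly"
  shows "Poly_Mapping.lookup (ncpoly_scale c f) m = c * Poly_Mapping.lookup f m"
proof -
  have "monomial [] = (1 :: ('x, 'k) ncpoly)"
    by (metis single_one zero_list_def)
  then show ?thesis
    using lookup_single_mult_single[of "[]" c f "[]" 1 m] by (simp add: ncpoly_scale_def)
qed

text \<open>The cofactors have coefficient one; field coefficients enter only through the span.
  \<open>D\<close> restricts the factorisations just as in \<open>reduction_step\<close>.\<close>

definition multiples ::
  "(('x, 'k::field) ncpoly \<Rightarrow> 'x list \<Rightarrow> 'x list \<Rightarrow> bool) \<Rightarrow> ('x, 'k) ncpoly set \<Rightarrow> ('x, 'k) ncpoly set"
  where "multiples D P = {monomial v1 * p * monomial v2 | p v1 v2. p \<in> P \<and> D p v1 v2}"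

lemma multiple_in_span:
  assumes "p \<in> P" "D p v1 v2"
  shows "Poly_Mapping.single v1 c * p * monomial v2 \<in> ncpoly.span (multiples D P)"
proof -
  have "monomial v1 * p * monomial v2 \<in> multiples D P"
    using assms unfolding multiples_def by blast
  from ncpoly.span_scale[OF ncpoly.span_base[OF this], of c] show ?thesis
    by (simp only: ncpoly_scale_mult_monomials)
qed

text \<open>Invariant of a run: current polynomial plus remainder equals \<open>f\<close> modulo the
  span. A subtraction changes the sum by a scaled multiple, and a move to the remainder leaves it
  unchanged. At the final pair \<open>(0, 0)\<close> this gives the claim.\<close>

lemma reduces_to_zero_in_span:
  assumes "reduces_to_zero ord D P f"
  shows "f \<in> ncpoly.span (multiples D P)"
proof -
  have "f - (fst s + snd s) \<in> ncpoly.span (multiples D P)"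
    if "(reduction_step ord D P)\<^sup>*\<^sup>* (f, 0) s" for s
    using that
  proof (induction rule: rtranclp_induct)
    case base
    show ?case by (simp add: ncpoly.span_zero)
  next
    case (step s t)
    from step.hyps(2) show ?case
    proof cases
      case (subtract g p v1 v2 r)
      let ?q = "Poly_Mapping.single v1 (LC ord g * inverse (LC ord p)) * p * monomial v2"
      have "?q \<in> ncpoly.span (multiples D P)"
        using subtract by (intro multiple_in_span)
      moreover have "f - (g + r) \<in> ncpoly.span (multiples D P)"
        using step.IH subtract by simp
      ultimately have "(f - (g + r)) + ?q \<in> ncpoly.span (multiples D P)"
        by (intro ncpoly.span_add)
      then show ?thesis using subtract by (simp add: algebra_simps)
    next
      case (to_remainder g r)
      then show ?thesis using step.IH by simp
    qed
  qed
  from this[of "(0, 0)"] assms show ?thesis by (simp add: reduces_to_zero_def)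
qed

section \<open>Reducing linear combinations of multiples\<close>

text \<open>\<open>D\<close> selects the summands and the weaker \<open>E\<close> the permitted
  steps, so that combinations of involutive multiples can be reduced by ordinary steps. Nonzero
  coefficients ensure that the greatest leading monomial survives in the sum.\<close>

lemma sum_multiples_reduces_to_zero:
  assumes adm: "admissible ord" and "0 \<notin> P" and inj: "inj_on (LM ord) (multiples D P)"
    and E: "\<And>p v1 v2. D p v1 v2 \<Longrightarrow> E p v1 v2"
    and "finite A" "A \<subseteq> multiples D P" "\<And>b. b \<in> A \<Longrightarrow> c b \<noteq> 0"
  shows "reduces_to_zero ord E P (\<Sum>b\<in>A. ncpoly_scale (c b) b)"
  using assms(5-)
proof (induction "card A" arbitrary: A)
  case 0
  then show ?case by (simp add: reduces_to_zero_def)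
next
  case (Suc n)
  let ?S = "\<lambda>A. \<Sum>b\<in>A. ncpoly_scale (c b) b"
  have "A \<noteq> {}" using Suc.hyps by auto
  then obtain b where b: "b \<in> A" and max: "\<And>a. a \<in> A \<Longrightarrow> LM ord a \<noteq> LM ord b \<Longrightarrow> (LM ord a, LM ord b) \<in> ord"
    using finite_strict_linear_order_max[of ord "LM ord ` A"] admissible_linear[OF adm] Suc.prems(1)
    by auto
  from b Suc.prems(2) obtain p v1 v2
    where beq: "b = monomial v1 * p * monomial v2" and p: "p \<in> P" and D: "D p v1 v2"
    unfolding multiples_def by blast
  have p0: "p \<noteq> 0" using p \<open>0 \<notin> P\<close> by blast
  have nz: "a \<noteq> 0" if "a \<in> A" for a
  proof -
    from that Suc.prems(2) obtain q w1 w2 where "a = monomial w1 * q * monomial w2" "q \<in> P"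
      unfolding multiples_def by blast
    with \<open>0 \<notin> P\<close> show ?thesis using mult_monomials_nonzero[OF adm, of q] by auto
  qed
  \<comment> \<open>By injectivity the maximum is attained at \<open>b\<close> alone, so no monomial
    of another summand can reach \<open>LM ord b\<close> and cancel it.\<close>
  have below: "(m, LM ord b) \<in> ord" if "a \<in> A" "a \<noteq> b" "m \<in> Poly_Mapping.keys a" for a m
  proof -
    have "LM ord a \<noteq> LM ord b" using inj that b Suc.prems(2) by (meson inj_onD subsetD)
    with that(1) have "(LM ord a, LM ord b) \<in> ord" by (rule max)
    then show ?thesis
      using LM_greatest[OF adm nz[OF that(1)] that(3)]
        transD[OF admissible_linear(1)[OF adm], of m "LM ord a" "LM ord b"]
      by (cases "m = LM ord a") simp_all
  qed
  have lookup: "Poly_Mapping.lookup (?S A) m = (\<Sum>a\<in>A. c a * Poly_Mapping.lookup a m)" for m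
    by (simp add: lookup_sum lookup_ncpoly_scale)
  have lead: "Poly_Mapping.lookup (?S A) (LM ord b) = c b * LC ord b"
  proof -
    have "Poly_Mapping.lookup a (LM ord b) = 0" if "a \<in> A - {b}" for a
      using below[of a "LM ord b"] that admissible_linear(2)[OF adm]
      by (auto simp: irrefl_def in_keys_iff)
    then show ?thesis
      unfolding lookup by (simp add: sum.remove[OF Suc.prems(1) b] LC_def)
  qed
  have LCb: "LC ord b = LC ord p" and LCp: "LC ord p \<noteq> 0"
    using beq LC_mult_monomials[OF adm p0] LM_in_keys[OF adm p0] by (auto simp: LC_def in_keys_iff)
  have cb: "c b \<noteq> 0" using b Suc.prems(3) by blast
  have LMS: "LM ord (?S A) = LM ord b"
  proof (rule LM_eqI[OF adm])
    show "LM ord b \<in> Poly_Mapping.keys (?S A)"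
      using lead LCb LCp cb by (simp add: in_keys_iff)
  next
    fix m assume m: "m \<in> Poly_Mapping.keys (?S A)" "m \<noteq> LM ord b"
    then have "(\<Sum>a\<in>A. c a * Poly_Mapping.lookup a m) \<noteq> 0" by (simp add: in_keys_iff lookup)
    then obtain a where "a \<in> A" "c a * Poly_Mapping.lookup a m \<noteq> 0"
      by (meson sum.not_neutral_contains_not_neutral)
    then have "a \<in> A" "m \<in> Poly_Mapping.keys a" by (auto simp: in_keys_iff)
    then show "(m, LM ord b) \<in> ord"
      using below m(2) LM_greatest[OF adm nz[OF b]] by (cases "a = b") auto
  qed
  have "?S A \<noteq> 0" using lead LCb LCp cb by auto
  moreover have "LM ord (?S A) = v1 @ LM ord p @ v2"
    using LMS beq LM_mult_monomials[OF adm p0] by simp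
  ultimately have "reduction_step ord E P (?S A, 0)
    (?S A - Poly_Mapping.single v1 (LC ord (?S A) * inverse (LC ord p)) * p * monomial v2, 0)"
    using p E[OF D] by (intro reduction_step.subtract)
  \<comment> \<open>The coefficient prescribed by the reduction step is exactly that of
    \<open>b\<close> in the sum, so the step deletes this summand and leaves the others
    untouched.\<close>
  moreover have "LC ord (?S A) * inverse (LC ord p) = c b"
    using lead LMS LCb LCp by (simp add: LC_def)
  moreover have "?S A - Poly_Mapping.single v1 (c b) * p * monomial v2 = ?S (A - {b})"
    using Suc.prems(1) b by (simp add: sum.remove beq ncpoly_scale_mult_monomials)
  ultimately have step: "reduction_step ord E P (?S A, 0) (?S (A - {b}), 0)" by simp
  have "reduces_to_zero ord E P (?S (A - {b}))"
    using Suc.hyps Suc.prems b by (intro Suc.hyps(1)) auto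
  with step show ?case
    unfolding reduces_to_zero_def by (rule converse_rtranclp_into_rtranclp)
qed

lemma span_multiples_reduces_to_zero:
  assumes "admissible ord" "0 \<notin> P" "inj_on (LM ord) (multiples D P)"
    and "f \<in> ncpoly.span (multiples D P)"
    and "\<And>p v1 v2. D p v1 v2 \<Longrightarrow> E p v1 v2"
  shows "reduces_to_zero ord E P f"
proof -
  obtain A c where A: "finite A" "A \<subseteq> multiples D P" "f = (\<Sum>b\<in>A. ncpoly_scale (c b) b)"
    using assms(4) unfolding ncpoly.span_explicit by blast
  \<comment> \<open>A representation in the span may have zero coefficients; these summands are
    dropped first.\<close>
  have "f = (\<Sum>b\<in>{b \<in> A. c b \<noteq> 0}. ncpoly_scale (c b) b)"
    unfolding A(3) using A(1) by (intro sum.mono_neutral_right) auto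
  also have "reduces_to_zero ord E P \<dots>"
    by (rule sum_multiples_reduces_to_zero[OF assms(1-3,5)]) (use A(1,2) in auto)
  finally show ?thesis .
qed

section \<open>Uniqueness of involutive divisors\<close>

text \<open>A common leading monomial lies in the cones of both basis elements. Nesting of the cones
  would put one basis leading monomial into the cone of a different basis element, against
  autoreduction; hence the elements agree, and Unique Divisor identifies the cofactors.\<close>

lemma inj_on_LM_involutive_multiples:
  fixes G :: "('x, 'k::field) ncpoly set"
  assumes "strong I" "admissible ord" "finite G" "0 \<notin> G" "autoreduced ord I G"
  shows "inj_on (LM ord) (multiples (\<lambda>p. inv_div_at I (LM ord ` G) (LM ord p)) G)"
proof (rule inj_onI)
  let ?U = "LM ord ` G"
  let ?B = "multiples (\<lambda>p. inv_div_at I ?U (LM ord p)) G"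
  have str: "disjoint_cones I ?U" "unique_divisor I ?U"
    using assms(1,3) by (auto simp: strong_def)
  \<comment> \<open>Here \<open>p\<close> and \<open>q\<close> are compared as polynomials, so
    together with \<open>self\<close> this also excludes distinct elements with equal leading
    monomials.\<close>
  have no_div: "LM ord p \<notin> inv_cone I ?U (LM ord q)" if "p \<in> G" "q \<in> G" "p \<noteq> q" for p q
  proof -
    have "p \<noteq> 0" using that(1) assms(4) by blast
    then have "LM ord p \<in> Poly_Mapping.keys p" by (rule LM_in_keys[OF assms(2)])
    moreover have "q \<in> G - {p}" using that by auto
    ultimately show ?thesis
      using that(1) assms(5) unfolding autoreduced_def inv_cone_def mem_Collect_eq by blast
  qed
  \<comment> \<open>With empty cofactors both conditions on multiplicative variables are
    vacuous.\<close>
  have self: "u \<in> inv_cone I ?U u" for u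
    by (auto simp: inv_cone_def inv_dvd_def inv_div_at_def intro!: exI[of _ "[]"])
  fix a b assume "a \<in> ?B" "b \<in> ?B" and eq: "LM ord a = LM ord b"
  then obtain p v1 v2 q w1 w2 where
    a: "a = monomial v1 * p * monomial v2" "p \<in> G" "inv_div_at I ?U (LM ord p) v1 v2" and
    b: "b = monomial w1 * q * monomial w2" "q \<in> G" "inv_div_at I ?U (LM ord q) w1 w2"
    unfolding multiples_def by blast
  have nz: "p \<noteq> 0" "q \<noteq> 0" using a(2) b(2) assms(4) by auto
  have w: "v1 @ LM ord p @ v2 = w1 @ LM ord q @ w2"
    using eq a(1) b(1) nz[THEN LM_mult_monomials[OF assms(2)]] by simp
  have cones: "v1 @ LM ord p @ v2 \<in> inv_cone I ?U (LM ord p)"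
    "v1 @ LM ord p @ v2 \<in> inv_cone I ?U (LM ord q)"
    using a(3) b(3) w unfolding inv_cone_def inv_dvd_def mem_Collect_eq by blast+
  have pq: "p = q"
  proof (rule ccontr)
    assume "p \<noteq> q"
    have "inv_cone I ?U (LM ord p) \<subseteq> inv_cone I ?U (LM ord q) \<or>
      inv_cone I ?U (LM ord q) \<subseteq> inv_cone I ?U (LM ord p)"
      using str(1) cones a(2) b(2) unfolding disjoint_cones_def by blast
    then show False using self no_div a(2) b(2) \<open>p \<noteq> q\<close> by blast
  qed
  have ex1: "\<exists>!(x, y). v1 @ LM ord p @ v2 = x @ LM ord p @ y \<and> inv_div_at I ?U (LM ord p) x y"
    using str(2) cones(1) a(2) unfolding unique_divisor_def by blast
  have "(v1, v2) = (w1, w2)"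
    using ex1 a(3) b(3) w pq by (elim ex1E) (smt (verit) case_prodI)
  with a(1) b(1) pq show "a = b" by simp
qed

section \<open>From involutive to ordinary reduction\<close>

theorem theorem5p4p4:
  fixes ord :: "'x::finite list rel"
    and I :: "'x involutive_division"
    and G :: "('x, 'k::field) ncpoly set"
  assumes "strong I"
    and "admissible ord"
    and "finite G"
    and "0 \<notin> G"
    and "involutive_basis ord I G"
  shows "groebner_basis ord G (two_sided_ideal hull G)"
proof -
  let ?D = "\<lambda>p. inv_div_at I (LM ord ` G) (LM ord p)"
  let ?V = "ncpoly.span (multiples ?D G)"
  have inj: "inj_on (LM ord) (multiples ?D G)"
    using assms by (intro inj_on_LM_involutive_multiples) (auto simp: involutive_basis_def)
  \<comment> \<open>The basis property is applied with coefficient one, since terms must be nonzero;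
    scaling in the span then yields every \<open>c\<close>, including zero.\<close>
  have mult: "Poly_Mapping.single l c * g * monomial r \<in> ?V" if "g \<in> G" for l r c g
  proof -
    have "is_term (monomial l :: ('x, 'k) ncpoly)" "is_term (monomial r :: ('x, 'k) ncpoly)"
      unfolding is_term_def using one_neq_zero by blast+
    then have "monomial l * g * monomial r \<in> ?V"
      using assms(5) that reduces_to_zero_in_span
      unfolding involutive_basis_def inv_reduces_to_zero_def by blast
    from ncpoly.span_scale[OF this, of c] show ?thesis
      by (simp only: ncpoly_scale_mult_monomials)
  qed
  have "reduces_to_zero ord (\<lambda>_ _ _. True) G s" if "s \<in> S_polynomials ord G" for s
  proof -
    have "s \<in> ?V"
      using that unfolding S_polynomials_def by (auto intro: ncpoly.span_diff mult)
    \<comment> \<open>Involutive steps are in particular ordinary ones, so \<open>E\<close> can be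
      taken to be always true.\<close>
    with assms(2,4) inj show ?thesis
      by (rule span_multiples_reduces_to_zero) simp
  qed
  then show ?thesis by (simp add: groebner_basis_def)
qed

end
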